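(* Let $y\in\mathbb C$, $y\neq\epsilon$, satisfy $X(y)=0$, let $n\in\mathbb Z$, and let $(t_i,A^{(i)})_{i\ge n}$ be a forward HH development with central parameter $t_n=y-\epsilon$. Then, with the appropriate choice of roots at the indices below $n$, the HH continued fraction is even symmetric with $\alpha_n$ as the centre of symmetry; that is, $(t_i,A^{(i)})_{i\ge n}$ extends to a two-sided HH development $(t_i,A^{(i)})_{i\in\mathbb Z}$ whose coefficients satisfy $\alpha_{n-i}=\alpha_{n+i}$ and $\beta_{n-i}=\beta_{n+i+1}$ for all $i\in\mathbb Z$.
   Context: Work over $\mathbb C$. Let $g\ge 1$, let $X$ be a polynomial in $x$ of degree $2g+2$ that is not the square of a polynomial, and let $\epsilon\in\mathbb C$ with $X(\epsilon)\ne 0$. Put $s=x-\epsilon$ and $S(s)=X(\epsilon+s)=\sum_{i=0}^{2g+2}p_is^i$, so $p_0=X(\epsilon)\neq0$. Fix $\sqrt{p_0}$ and let $\sqrt X$ be the analytic branch near $s=0$ with value $\sqrt{p_0}$ at $s=0$. A (regular) two-sided HH (hyperelliptic Halphen) development is a sequence $(t_i,A^{(i)})_{i\in\mathbb Z}$, with $t_i\in\mathbb C\setminus\{0\}$ and $A^{(i)}\in\mathbb C[s]$ of degree at most $g+1$, such that for every $i$: $A^{(i)}\equiv\sqrt X \pmod{s^{g+1}}$; $S-(A^{(i)})^2=s^{g+1}(s-t_i)B^{(i)}$ with $B^{(i)}$ a polynomial of degree exactly $g$ with no root equal to $0$; $B^{(i)}(t_{i+1})=0$; and $A^{(i)}(t_{i+1})=-A^{(i+1)}(t_{i+1})$.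 A forward HH development $(t_i,A^{(i)})_{i\ge n}$ is a sequence indexed by $i\ge n$ satisfying these same conditions for all $i\ge n$. (For $g>1$ the development involves at each step the choice of one root $t_{i+1}$ of $B^{(i)}$, and going backward the choice of one root $t_{i-1}$ of $(S-(A^{(i-1)})^2)/(s^{g+1}(s-t_i))$.) The coefficients of the associated HH continued fraction are $$\alpha_i=\frac{A^{(i-1)}(s)-A^{(i-1)}(t_i)}{s-t_i}+\frac{A^{(i)}(s)-A^{(i)}(t_i)}{s-t_i},\qquad \beta_i=\frac{s^{g+1}B^{(i-1)}(s)}{s-t_i}.$$ The HH continued fraction is even symmetric with $\alpha_n$ as the centre of symmetry if $\alpha_{n-i}=\alpha_{n+i}$ and $\beta_{n-i}=\beta_{n+i+1}$ for all $i$. *)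

theory Defs
  imports "HOL-Analysis.Analysis" "HOL-Computational_Algebra.Polynomial"
begin

definition sqrt_branch :: "complex poly \<Rightarrow> complex \<Rightarrow> (complex \<Rightarrow> complex) \<Rightarrow> bool" where
  "sqrt_branch S r f \<longleftrightarrow>
     f analytic_on {0} \<and> f 0 = r \<and> (\<forall>\<^sub>F s in nhds 0. (f s)\<^sup>2 = poly S s)"

text \<open>Congruence modulo \<open>s ^ m\<close> in the ring of germs of analytic functions at \<open>0\<close>.\<close>

definition germ_cong :: "nat \<Rightarrow> (complex \<Rightarrow> complex) \<Rightarrow> (complex \<Rightarrow> complex) \<Rightarrow> bool" where
  "germ_cong m f h \<longleftrightarrow>
     (\<exists>q. q analytic_on {0} \<and> (\<forall>\<^sub>F s in nhds 0. f s - h s = s ^ m * q s))"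

text \<open>The cofactor \<open>B\<close> is determined by \<open>t\<close> and \<open>A\<close>; that the division is exact is
  demanded in \<open>HH_development_on\<close>.\<close>

definition HH_B ::
  "complex poly \<Rightarrow> nat \<Rightarrow> (int \<Rightarrow> complex) \<Rightarrow> (int \<Rightarrow> complex poly) \<Rightarrow> int \<Rightarrow> complex poly" where
  "HH_B S g t A i = (S - (A i)\<^sup>2) div (monom 1 (g + 1) * [:- t i, 1:])"

text \<open>\<open>I\<close> is \<open>UNIV\<close> for a two-sided development and \<open>{n..}\<close> for a forward one; values of
  \<open>t\<close> and \<open>A\<close> outside \<open>I\<close> are then irrelevant, since these sets are closed under successor.
  The function \<open>f\<close> is the chosen branch of the square root of \<open>S\<close>.\<close>

definition HH_development_on ::
  "int set \<Rightarrow> complex poly \<Rightarrow> (complex \<Rightarrow> complex) \<Rightarrow> nat \<Rightarrow>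
     (int \<Rightarrow> complex) \<Rightarrow> (int \<Rightarrow> complex poly) \<Rightarrow> bool" where
  "HH_development_on I S f g t A \<longleftrightarrow>
     (\<forall>i\<in>I.
        t i \<noteq> 0 \<and>
        degree (A i) \<le> g + 1 \<and>
        germ_cong (g + 1) (poly (A i)) f \<and>
        S - (A i)\<^sup>2 = monom 1 (g + 1) * [:- t i, 1:] * HH_B S g t A i \<and>
        degree (HH_B S g t A i) = g \<and>
        poly (HH_B S g t A i) 0 \<noteq> 0 \<and>
        poly (HH_B S g t A i) (t (i + 1)) = 0 \<and>
        poly (A i) (t (i + 1)) = - poly (A (i + 1)) (t (i + 1)))"

abbreviation HH_two_sided ::
  "complex poly \<Rightarrow> (complex \<Rightarrow> complex) \<Rightarrow> nat \<Rightarrow>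
     (int \<Rightarrow> complex) \<Rightarrow> (int \<Rightarrow> complex poly) \<Rightarrow> bool" where
  "HH_two_sided \<equiv> HH_development_on UNIV"

abbreviation HH_forward ::
  "int \<Rightarrow> complex poly \<Rightarrow> (complex \<Rightarrow> complex) \<Rightarrow> nat \<Rightarrow>
     (int \<Rightarrow> complex) \<Rightarrow> (int \<Rightarrow> complex poly) \<Rightarrow> bool" where
  "HH_forward n \<equiv> HH_development_on {n..}"

text \<open>All polynomial divisions below are exact: those in \<open>HH_alpha\<close> always, the one in
  \<open>HH_beta\<close> because \<open>t i\<close> is a root of \<open>HH_B S g t A (i - 1)\<close> in a development.\<close>

definition HH_alpha :: "(int \<Rightarrow> complex) \<Rightarrow> (int \<Rightarrow> complex poly) \<Rightarrow> int \<Rightarrow> complex poly" where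
  "HH_alpha t A i =
     (A (i - 1) - [:poly (A (i - 1)) (t i):]) div [:- t i, 1:] +
     (A i - [:poly (A i) (t i):]) div [:- t i, 1:]"

definition HH_beta ::
  "complex poly \<Rightarrow> nat \<Rightarrow> (int \<Rightarrow> complex) \<Rightarrow> (int \<Rightarrow> complex poly) \<Rightarrow> int \<Rightarrow> complex poly" where
  "HH_beta S g t A i = (monom 1 (g + 1) * HH_B S g t A (i - 1)) div [:- t i, 1:]"

definition even_symmetric :: "(int \<Rightarrow> 'a) \<Rightarrow> (int \<Rightarrow> 'a) \<Rightarrow> int \<Rightarrow> bool" where
  "even_symmetric \<alpha> \<beta> n \<longleftrightarrow>
     (\<forall>i. \<alpha> (n - i) = \<alpha> (n + i)) \<and> (\<forall>i. \<beta> (n - i) = \<beta> (n + i + 1))"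

end

theory Submission
  imports Defs
begin

text \<open>Reflect the development about \<open>n\<close>: \<open>t (n - j) = t (n + j)\<close> and \<open>A (n - 1 - j) = A (n + j)\<close>.
  Writing \<open>S - (A i)\<^sup>2 = s ^ (g + 1) * (s - t i) * (s - t (i + 1)) * C\<close>, the conditions at \<open>i\<close> are
  symmetric in \<open>t i\<close> and \<open>t (i + 1)\<close>, so they survive the reflection. The only new condition is the
  one joining the two halves, namely that \<open>A n\<close> and \<open>- A n\<close> agree at \<open>t n\<close>; it holds because the
  square of \<open>A n\<close> takes at \<open>t n\<close> the value \<open>S (t n) = X y = 0\<close>.\<close>

lemma HH_B_eqI:
  assumes "S - (A i)\<^sup>2 = monom 1 (g + 1) * [:- t i, 1:] * B"
  shows "HH_B S g t A i = B"
proof -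
  have "monom 1 (g + 1) * [:- t i, 1:] \<noteq> (0 :: complex poly)"
    by (simp only: mult_eq_0_iff monom_eq_0_iff pCons_eq_0_iff) simp
  then show ?thesis
    unfolding HH_B_def assms by (rule nonzero_mult_div_cancel_left)
qed

lemma HH_beta_eqI:
  assumes "HH_B S g t A (i - 1) = [:- t i, 1:] * C"
  shows "HH_beta S g t A i = monom 1 (g + 1) * C"
proof -
  have "[:- t i, 1:] \<noteq> (0 :: complex poly)"
    by simp
  then have "[:- t i, 1:] * (monom 1 (g + 1) * C) div [:- t i, 1:] = monom 1 (g + 1) * C"
    by (rule nonzero_mult_div_cancel_left)
  then show ?thesis
    by (simp only: HH_beta_def assms mult.left_commute)
qed

lemma degree_linear_mult:
  assumes "C \<noteq> (0 :: 'a :: idom poly)"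
  shows "degree ([:a, 1:] * C) = degree C + 1"
  using assms by (subst degree_mult_eq) auto

text \<open>The root \<open>t (i + 1)\<close> of \<open>HH_B\<close> splits off. What remains,
  \<open>C\<close>, depends on \<open>t i\<close> and \<open>t (i + 1)\<close> only as an unordered
  pair, so the same \<open>C\<close> will serve the mirrored index.\<close>

lemma HH_development_on_factor:
  assumes "HH_development_on I S f g t A" and "i \<in> I"
  obtains C where "HH_B S g t A i = [:- t (i + 1), 1:] * C"
    and "S - (A i)\<^sup>2 = monom 1 (g + 1) * [:- t i, 1:] * ([:- t (i + 1), 1:] * C)"
    and "degree C + 1 = g" and "poly C 0 \<noteq> 0"
proof -
  have B: "S - (A i)\<^sup>2 = monom 1 (g + 1) * [:- t i, 1:] * HH_B S g t A i"
    "degree (HH_B S g t A i) = g" "poly (HH_B S g t A i) 0 \<noteq> 0"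
    "poly (HH_B S g t A i) (t (i + 1)) = 0"
    using assms by (auto simp: HH_development_on_def)
  then obtain C where C: "HH_B S g t A i = [:- t (i + 1), 1:] * C"
    by (auto simp: poly_eq_0_iff_dvd elim: dvdE)
  have "poly C 0 \<noteq> 0"
    using B(3) by (auto simp: C)
  moreover from this have "C \<noteq> 0"
    by auto
  then have "degree C + 1 = g"
    using B(2) C degree_linear_mult by metis
  ultimately show thesis
    using that C B(1) by metis
qed

theorem theorem3:
  fixes g :: nat and X S :: "complex poly" and \<epsilon> r y :: complex
    and f :: "complex \<Rightarrow> complex" and n :: int
    and t :: "int \<Rightarrow> complex" and A :: "int \<Rightarrow> complex poly"
  assumes "g \<ge> 1"
    and "degree X = 2 * g + 2"
    and "\<not> (\<exists>q. X = q\<^sup>2)"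
    and "poly X \<epsilon> \<noteq> 0"
    and "S = pcompose X [:\<epsilon>, 1:]"
    and "r\<^sup>2 = poly X \<epsilon>"
    and "sqrt_branch S r f"
    and "y \<noteq> \<epsilon>"
    and "poly X y = 0"
    and "HH_forward n S f g t A"
    and "t n = y - \<epsilon>"
  shows "\<exists>t' A'. (\<forall>i\<ge>n. t' i = t i \<and> A' i = A i) \<and>
           HH_two_sided S f g t' A' \<and>
           even_symmetric (HH_alpha t' A') (HH_beta S g t' A') n"
proof -
  have fwd: "HH_development_on {n..} S f g t A"
    by fact
  define t' where "t' i = t (n + \<bar>i - n\<bar>)" for i
  \<comment> \<open>\<open>A i\<close> belongs to the pair \<open>t i\<close>,
    \<open>t (i + 1)\<close>. The reflection sending i to 2n - i carries the positions i, i + 1 to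
    2n - i, 2n - 1 - i, whose smaller member indexes the mirrored polynomial.\<close>
  define A' where "A' i = A (if n \<le> i then i else 2 * n - 1 - i)" for i
  have t'_ge: "t' i = t i" and A'_ge: "A' i = A i" if "n \<le> i" for i
    using that by (simp_all add: t'_def A'_def)
  have B'_ge: "HH_B S g t' A' i = HH_B S g t A i" if "n \<le> i" for i
    using that by (simp add: HH_B_def t'_ge A'_ge)
  have t'_sym: "t' (n - j) = t' (n + j)" for j
    by (simp add: t'_def)
  have A'_sym: "A' (n - 1 - j) = A' (n + j)" for j
    by (auto simp: A'_def algebra_simps intro!: arg_cong[of _ _ A])
  have refl_eqs: "t' (n - 1 - j) = t (n + j + 1)" "t' (n - j) = t (n + j)" "A' (n - 1 - j) = A (n + j)"
    if "0 \<le> j" for j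
    using t'_sym[of "j + 1"] t'_sym[of j] A'_sym[of j] that
    by (simp_all add: t'_ge A'_ge algebra_simps)

  \<comment> \<open>One cofactor \<open>C\<close> for both mirrored indices n + j and n - 1 - j. It
    yields the conditions on \<open>HH_B\<close> below n as well as the symmetry of the
    \<beta>.\<close>
  have B'_refl: "\<exists>C. HH_B S g t' A' (n + j) = [:- t' (n + j + 1), 1:] * C
      \<and> S - (A' (n - 1 - j))\<^sup>2 = monom 1 (g + 1) * [:- t' (n - 1 - j), 1:] * ([:- t' (n - j), 1:] * C)
      \<and> HH_B S g t' A' (n - 1 - j) = [:- t' (n - j), 1:] * C
      \<and> degree C + 1 = g \<and> poly C 0 \<noteq> 0"
    if "0 \<le> j" for j
  proof -
    have nj: "n + j \<in> {n..}"
      using that by simp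
    obtain C where C: "HH_B S g t A (n + j) = [:- t (n + j + 1), 1:] * C"
      "S - (A (n + j))\<^sup>2 = monom 1 (g + 1) * [:- t (n + j), 1:] * ([:- t (n + j + 1), 1:] * C)"
      "degree C + 1 = g" "poly C 0 \<noteq> 0"
      using HH_development_on_factor[OF fwd nj] by blast
    have t'_Suc: "t' (n + j + 1) = t (n + j + 1)"
      using that by (simp add: t'_ge)
    note eqs = refl_eqs[OF that] t'_Suc
    have S: "S - (A' (n - 1 - j))\<^sup>2 =
        monom 1 (g + 1) * [:- t' (n - 1 - j), 1:] * ([:- t' (n - j), 1:] * C)"
      \<comment> \<open>Only the two linear factors change places.\<close>
      unfolding eqs C(2) by (simp only: ac_simps)
    show ?thesis
      using C(1,3,4) S HH_B_eqI[where A = A' and t = t', OF S] that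
      by (auto simp only: eqs B'_ge)
  qed

  have "S - (A n)\<^sup>2 = monom 1 (g + 1) * [:- t n, 1:] * HH_B S g t A n"
    using fwd by (auto simp: HH_development_on_def)
  \<comment> \<open>The factor s - \<open>t n\<close> vanishes at \<open>t n\<close>, so
    \<open>(A n)\<^sup>2\<close> and \<open>S\<close> agree there.\<close>
  then have "poly (S - (A n)\<^sup>2) (t n) = 0"
    by simp
  moreover have "poly S (t n) = 0"
    using assms by (simp add: poly_pcompose)
  ultimately have A_centre: "poly (A n) (t n) = 0"
    by simp

  have dev: "HH_two_sided S f g t' A'"
    unfolding HH_development_on_def
  proof
    fix i :: int
    show "t' i \<noteq> 0 \<and> degree (A' i) \<le> g + 1 \<and> germ_cong (g + 1) (poly (A' i)) f \<and>
        S - (A' i)\<^sup>2 = monom 1 (g + 1) * [:- t' i, 1:] * HH_B S g t' A' i \<and>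
        degree (HH_B S g t' A' i) = g \<and> poly (HH_B S g t' A' i) 0 \<noteq> 0 \<and>
        poly (HH_B S g t' A' i) (t' (i + 1)) = 0 \<and>
        poly (A' i) (t' (i + 1)) = - poly (A' (i + 1)) (t' (i + 1))"
    proof (cases "n \<le> i")
      case True
      then show ?thesis
        using fwd by (simp add: HH_development_on_def t'_ge A'_ge B'_ge)
    next
      case False
      define j where "j = n - 1 - i"
      have j: "0 \<le> j" "i = n - 1 - j" "i + 1 = n - j"
        using False by (auto simp: j_def)
      obtain C where C: "S - (A' i)\<^sup>2 = monom 1 (g + 1) * [:- t' i, 1:] * ([:- t' (i + 1), 1:] * C)"
        "HH_B S g t' A' i = [:- t' (i + 1), 1:] * C" "degree C + 1 = g" "poly C 0 \<noteq> 0"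
        using B'_refl[OF j(1), folded j(2,3)] by blast
      note eqs = refl_eqs[OF j(1), folded j(2,3)]
      have nz: "t (n + j) \<noteq> 0" "t (n + j + 1) \<noteq> 0"
        and A: "degree (A (n + j)) \<le> g + 1" "germ_cong (g + 1) (poly (A (n + j))) f"
        using fwd j(1) by (auto simp: HH_development_on_def)
      have "C \<noteq> 0"
        using C(4) by auto
      then have deg: "degree (HH_B S g t' A' i) = g"
        using C(2,3) degree_linear_mult by metis
      \<comment> \<open>For j = 0 this is the junction, where both polynomials are
        \<open>A n\<close>. For j > 0 it is the forward condition at index n + j - 1 with its two
        sides exchanged.\<close>
      have "poly (A (n + j)) (t (n + j)) = - poly (A' (i + 1)) (t (n + j))"
      proof (cases "j = 0")
        case True
        then show ?thesis
          using A_centre by (simp add: j(3) A'_ge)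
      next
        case False
        then have "A' (i + 1) = A (n + (j - 1))"
          using A'_sym[of "j - 1"] j by (simp add: A'_ge)
        moreover have "n + (j - 1) \<in> {n..}"
          using False j(1) by simp
        then have "poly (A (n + (j - 1))) (t (n + (j - 1) + 1)) =
            - poly (A (n + (j - 1) + 1)) (t (n + (j - 1) + 1))"
          using fwd unfolding HH_development_on_def by blast
        ultimately show ?thesis
          by simp
      qed
      then show ?thesis
        using nz A C deg by (simp add: eqs)
    qed
  qed

  have beta: "HH_beta S g t' A' (n - j) = HH_beta S g t' A' (n + j + 1)" if j: "0 \<le> j" for j
  proof -
    obtain C where C: "HH_B S g t' A' (n + j) = [:- t' (n + j + 1), 1:] * C"
      "HH_B S g t' A' (n - 1 - j) = [:- t' (n - j), 1:] * C"
      using B'_refl[OF j] by blast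
    have "HH_beta S g t' A' (n - j) = monom 1 (g + 1) * C"
      using C(2) by (intro HH_beta_eqI) (simp add: algebra_simps)
    moreover have "HH_beta S g t' A' (n + j + 1) = monom 1 (g + 1) * C"
      using C(1) by (intro HH_beta_eqI) simp
    ultimately show ?thesis
      by simp
  qed
  have "even_symmetric (HH_alpha t' A') (HH_beta S g t' A') n"
    unfolding even_symmetric_def
  proof (intro conjI allI)
    fix i
    \<comment> \<open>The reflection swaps the two polynomials entering \<alpha>, and \<alpha> is a
      sum symmetric in them.\<close>
    have "A' (n - i - 1) = A' (n + i)" "A' (n - i) = A' (n + i - 1)"
      using A'_sym[of i] A'_sym[of "i - 1"] by (simp_all add: algebra_simps)
    then show "HH_alpha t' A' (n - i) = HH_alpha t' A' (n + i)"
      by (simp add: HH_alpha_def t'_sym add.commute)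
    show "HH_beta S g t' A' (n - i) = HH_beta S g t' A' (n + i + 1)"
      \<comment> \<open>Replacing i by -i - 1 exchanges the indices n - i and n + i + 1, which
        reduces negative i to the case already proved.\<close>
      using beta[of i] beta[of "- i - 1"] by (cases "0 \<le> i") (simp_all add: algebra_simps)
  qed
  with dev t'_ge A'_ge show ?thesis
    by blast
qed

end
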